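(* $\chi_{la}(C_8(1,2,3))=\chi(C_8(1,2,3))=4$.
   Context: The circulant graph $C_n(1,a_1,\dots,a_t)$ has vertex set $\mathbb{Z}_n$, with $i$ and $j$ adjacent iff their cyclic distance $\min(|i-j|, n-|i-j|)$ lies in $\{1,a_1,\dots,a_t\}$. $\chi$ is the chromatic number. For a simple graph $G=(V,E)$ with $q$ edges, a bijection $f:E\to\{1,\dots,q\}$ is a local antimagic labeling if $f^+(u)\neq f^+(v)$ for every edge $uv$, where $f^+(u)=\sum_{e\ni u} f(e)$. The local antimagic chromatic number $\chi_{la}(G)$ is the minimum number of distinct values of $f^+$ over all local antimagic labelings $f$ of $G$. *)

theory Defs
  imports Main "HOL-Library.Extended_Nat"
begin

text \<open>
  A graph is given by a vertex set and a set of edges, an edge being the set of its two endpoints.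
\<close>

definition cyclic_dist :: "int \<Rightarrow> int \<Rightarrow> int \<Rightarrow> int" where
  "cyclic_dist n i j = min \<bar>i - j\<bar> (n - \<bar>i - j\<bar>)"

text \<open>
  The integers modulo \<open>n\<close> are represented by their residues \<open>0, \<dots>, n - 1\<close>.
  The set \<open>D\<close> is the full set of distances \<open>{1, a\<^sub>1, \<dots>, a\<^sub>t}\<close>, with the \<open>1\<close> listed explicitly.
\<close>

definition circulant_verts :: "int \<Rightarrow> int set" where
  "circulant_verts n = {0..<n}"

definition circulant_edges :: "int \<Rightarrow> int set \<Rightarrow> int set set" where
  "circulant_edges n D =
     {{i, j} | i j. i \<in> circulant_verts n \<and> j \<in> circulant_verts n \<and> cyclic_dist n i j \<in> D}"

definition proper_coloring :: "'a set \<Rightarrow> 'a set set \<Rightarrow> nat \<Rightarrow> ('a \<Rightarrow> nat) \<Rightarrow> bool" where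
  "proper_coloring V E k c \<longleftrightarrow>
     c ` V \<subseteq> {..<k} \<and> (\<forall>u\<in>V. \<forall>v\<in>V. {u, v} \<in> E \<longrightarrow> c u \<noteq> c v)"

text \<open>
  Both invariants are infima in \<^typ>\<open>enat\<close>: a nonempty set of extended naturals attains its
  infimum, and the value is \<open>\<infinity>\<close> exactly when no coloring (labeling) of the required kind exists.
\<close>

definition chromatic_number :: "'a set \<Rightarrow> 'a set set \<Rightarrow> enat" where
  "chromatic_number V E = (INF k\<in>{k. \<exists>c. proper_coloring V E k c}. enat k)"

definition vertex_sum :: "'a set set \<Rightarrow> ('a set \<Rightarrow> nat) \<Rightarrow> 'a \<Rightarrow> nat" where
  "vertex_sum E f u = (\<Sum>e\<in>{e \<in> E. u \<in> e}. f e)"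

definition local_antimagic_labeling :: "'a set \<Rightarrow> 'a set set \<Rightarrow> ('a set \<Rightarrow> nat) \<Rightarrow> bool" where
  "local_antimagic_labeling V E f \<longleftrightarrow>
     bij_betw f E {1..card E} \<and>
     (\<forall>u\<in>V. \<forall>v\<in>V. {u, v} \<in> E \<longrightarrow> vertex_sum E f u \<noteq> vertex_sum E f v)"

definition local_antimagic_chromatic_number :: "'a set \<Rightarrow> 'a set set \<Rightarrow> enat" where
  "local_antimagic_chromatic_number V E =
     (INF f\<in>{f. local_antimagic_labeling V E f}. enat (card (vertex_sum E f ` V)))"

end

theory Submission
  imports Defs
begin

text \<open>
  The graph is the complete multipartite graph \<open>K\<^bsub>2,2,2,2\<^esub>\<close> whose parts are the antipodal pairs
  \<open>{i, i + 4}\<close>.  The clique \<open>{0, 1, 2, 3}\<close> forces four colors, and the vertex sums of a local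
  antimagic labeling are a proper coloring, so \<open>4 \<le> \<chi> \<le> \<chi>\<^sub>l\<^sub>a\<close>.  An explicit labeling whose
  vertex sums agree on antipodal vertices shows \<open>\<chi>\<^sub>l\<^sub>a \<le> 4\<close>.
\<close>

text \<open>Renumbering the finitely many values of \<open>g\<close> by an initial segment of the
  naturals turns \<open>g\<close> into a proper coloring.\<close>

lemma chromatic_number_le_card_image:
  assumes "finite V" and "\<And>u v. u \<in> V \<Longrightarrow> v \<in> V \<Longrightarrow> {u, v} \<in> E \<Longrightarrow> g u \<noteq> g v"
  shows "chromatic_number V E \<le> enat (card (g ` V))"
proof -
  obtain h where h: "bij_betw h (g ` V) {0..<card (g ` V)}"
    using ex_bij_betw_finite_nat assms(1) by blast
  have "proper_coloring V E (card (g ` V)) (h \<circ> g)"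
    unfolding proper_coloring_def
  proof (intro conjI ballI impI)
    show "(h \<circ> g) ` V \<subseteq> {..<card (g ` V)}"
      using h by (auto simp: bij_betw_def)
    show "(h \<circ> g) u \<noteq> (h \<circ> g) v" if "u \<in> V" "v \<in> V" "{u, v} \<in> E" for u v
      using assms(2)[OF that] that h by (auto simp: bij_betw_def inj_on_def)
  qed
  then show ?thesis
    unfolding chromatic_number_def by (intro INF_lower) blast
qed

text \<open>Each labeling bounds \<open>chromatic_number\<close> through its vertex sums; if there
  is none, the right side is \<infinity>.\<close>

lemma chromatic_number_le_local_antimagic:
  assumes "finite V"
  shows "chromatic_number V E \<le> local_antimagic_chromatic_number V E"
  unfolding local_antimagic_chromatic_number_def
  by (intro INF_greatest chromatic_number_le_card_image)
     (use assms in \<open>auto simp: local_antimagic_labeling_def\<close>)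

text \<open>A proper coloring is injective on a clique.\<close>

lemma clique_le_chromatic_number:
  assumes "K \<subseteq> V" and "\<And>u v. u \<in> K \<Longrightarrow> v \<in> K \<Longrightarrow> u \<noteq> v \<Longrightarrow> {u, v} \<in> E"
  shows "enat (card K) \<le> chromatic_number V E"
  unfolding chromatic_number_def
proof (rule INF_greatest)
  fix k assume "k \<in> {k. \<exists>c. proper_coloring V E k c}"
  then obtain c where c: "proper_coloring V E k c" by blast
  then have "inj_on c K" "c ` K \<subseteq> {..<k}"
    using assms by (auto simp: proper_coloring_def inj_on_def subset_iff) metis
  then have "card K \<le> k"
    using card_inj_on_le[of c K "{..<k}"] by simp
  then show "enat (card K) \<le> enat k" by simp
qed

text \<open>An explicit list, so that the simplifier can evaluate label tables and vertex
  sums.\<close>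

definition edge_list :: "int set list" where
  "edge_list =
    [{0,1}, {0,2}, {0,3}, {0,5}, {0,6}, {0,7}, {1,2}, {1,3}, {1,4}, {1,6}, {1,7}, {2,3},
     {2,4}, {2,5}, {2,7}, {3,4}, {3,5}, {3,6}, {4,5}, {4,6}, {4,7}, {5,6}, {5,7}, {6,7}]"

text \<open>The table, found by computer search, is indexed by the smaller and then the larger endpoint.\<close>

definition labeling :: "int set \<Rightarrow> nat" where
  "labeling e =
    [[0, 1, 10, 21,  0,  5, 20,  7],
     [0, 0, 22, 19,  9,  0,  2, 15],
     [0, 0,  0, 17, 14, 11,  0,  6],
     [0, 0,  0,  0, 16,  3, 12,  0],
     [0, 0,  0,  0,  0,  8,  4, 13],
     [0, 0,  0,  0,  0,  0, 18, 23],
     [0, 0,  0,  0,  0,  0,  0, 24]] ! nat (Min e) ! nat (Max e)"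

lemma circulant_verts_8: "circulant_verts 8 = {0, 1, 2, 3, 4, 5, 6, 7}"
  unfolding circulant_verts_def set_eq_iff by (simp, presburger)

lemma circulant_edges_8: "circulant_edges 8 {1, 2, 3} = set edge_list"
proof
  show "circulant_edges 8 {1, 2, 3} \<subseteq> set edge_list"
  proof
    fix e assume "e \<in> circulant_edges 8 {1, 2, 3}"
    then obtain i j where e: "e = {i, j}" and i: "i \<in> circulant_verts 8"
      and j: "j \<in> circulant_verts 8" and d: "cyclic_dist 8 i j \<in> {1, 2, 3}"
      unfolding circulant_edges_def by blast
    \<comment> \<open>Of the 64 pairs, the equal and antipodal ones have distance 0 or 4 and
      contradict \<open>d\<close>.\<close>
    from i j d have "{i, j} \<in> set edge_list"
      unfolding circulant_verts_8
      by (elim insertE[of i] insertE[of j] emptyE;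
          simp add: cyclic_dist_def edge_list_def doubleton_eq_iff)
    with e show "e \<in> set edge_list" by simp
  qed
  have edge: "{i, j} \<in> circulant_edges 8 {1, 2, 3}"
    if "i \<in> circulant_verts 8" "j \<in> circulant_verts 8" "cyclic_dist 8 i j \<in> {1, 2, 3}" for i j
    using that unfolding circulant_edges_def by blast
  show "set edge_list \<subseteq> circulant_edges 8 {1, 2, 3}"
    by (simp add: edge_list_def edge circulant_verts_def cyclic_dist_def)
qed

lemma labeling_bij: "bij_betw labeling (set edge_list) {1..card (set edge_list)}"
proof -
  have labels: "map labeling edge_list =
      [1, 10, 21, 5, 20, 7, 22, 19, 9, 2, 15, 17, 14, 11, 6, 16, 3, 12, 8, 4, 13, 18, 23, 24]"
    by (simp add: edge_list_def labeling_def)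
  \<comment> \<open>Distinct labels give injectivity and also distinctness of the edges, hence their
    number.\<close>
  then have "distinct (map labeling edge_list)"
    by simp
  then have inj: "inj_on labeling (set edge_list)" and "distinct edge_list"
    by (simp_all add: distinct_map)
  then have card: "card (set edge_list) = 24"
    by (simp add: distinct_card) (simp add: edge_list_def)
  have "set (map labeling edge_list) \<subseteq> {1..24}"
    unfolding labels by simp
  \<comment> \<open>Surjectivity by counting: 24 distinct labels fill a 24-element set.\<close>
  then have "labeling ` set edge_list = {1..24}"
    using card_image[OF inj] card by (intro card_subset_eq) simp_all
  with inj card show ?thesis
    by (simp add: bij_betw_def)
qed

text \<open>Reducing mod 4 identifies antipodal vertices, so each part has a single sum.\<close>

lemma vertex_sum_labeling:
  assumes "u \<in> circulant_verts 8"
  shows "vertex_sum (set edge_list) labeling u = [64, 68, 80, 88] ! nat (u mod 4)"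
proof -
  have "vertex_sum (set edge_list) labeling u = (\<Sum>e\<in>set (filter ((\<in>) u) edge_list). labeling e)"
    by (simp add: vertex_sum_def)
  also have "\<dots> = [64, 68, 80, 88] ! nat (u mod 4)"
    using assms unfolding circulant_verts_8
    by (elim insertE emptyE; simp add: edge_list_def labeling_def doubleton_eq_iff)
  finally show ?thesis .
qed

lemma labeling_local_antimagic:
  "local_antimagic_labeling (circulant_verts 8) (set edge_list) labeling"
  unfolding local_antimagic_labeling_def
proof (intro conjI ballI impI)
  show "bij_betw labeling (set edge_list) {1..card (set edge_list)}"
    by (rule labeling_bij)
  fix u v :: int
  assume uv: "u \<in> circulant_verts 8" "v \<in> circulant_verts 8" and e: "{u, v} \<in> set edge_list"
  \<comment> \<open>The ends of an edge differ mod 4, and the four table values are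
    distinct.\<close>
  from e show "vertex_sum (set edge_list) labeling u \<noteq> vertex_sum (set edge_list) labeling v"
    unfolding vertex_sum_labeling[OF uv(1)] vertex_sum_labeling[OF uv(2)]
    by (auto simp: edge_list_def doubleton_eq_iff)
qed

theorem theorem2p7:
  shows "local_antimagic_chromatic_number (circulant_verts 8) (circulant_edges 8 {1, 2, 3})
           = chromatic_number (circulant_verts 8) (circulant_edges 8 {1, 2, 3})
       \<and> chromatic_number (circulant_verts 8) (circulant_edges 8 {1, 2, 3}) = 4"
proof -
  let ?V = "circulant_verts 8" and ?E = "set edge_list"
  \<comment> \<open>One vertex from each antipodal pair gives a clique.\<close>
  have "{u, v} \<in> ?E" if "u \<in> {0, 1, 2, 3}" "v \<in> {0, 1, 2, 3}" "u \<noteq> v" for u v :: int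
    using that by (elim insertE emptyE; simp add: edge_list_def doubleton_eq_iff)
  then have "enat (card {0, 1, 2, 3 :: int}) \<le> chromatic_number ?V ?E"
    by (intro clique_le_chromatic_number) (simp_all add: circulant_verts_8)
  then have lower: "4 \<le> chromatic_number ?V ?E"
    by (simp add: numeral_eq_enat eval_nat_numeral)
  have mid: "chromatic_number ?V ?E \<le> local_antimagic_chromatic_number ?V ?E"
    by (rule chromatic_number_le_local_antimagic) (simp add: circulant_verts_8)
  have "vertex_sum ?E labeling ` ?V = (\<lambda>u. [64, 68, 80, 88] ! nat (u mod 4)) ` ?V"
    using vertex_sum_labeling by (rule image_cong[OF refl])
  also have "\<dots> = {64, 68, 80, 88}"
    by (simp add: circulant_verts_8 insert_commute)
  finally have "card (vertex_sum ?E labeling ` ?V) = 4" by simp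
  moreover have "local_antimagic_chromatic_number ?V ?E \<le> enat (card (vertex_sum ?E labeling ` ?V))"
    unfolding local_antimagic_chromatic_number_def
    by (rule INF_lower) (simp add: labeling_local_antimagic)
  ultimately have upper: "local_antimagic_chromatic_number ?V ?E \<le> 4"
    by (simp add: numeral_eq_enat)
  show ?thesis
    unfolding circulant_edges_8 using lower mid upper by (auto intro: antisym order_trans)
qed

end
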